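(* Let $P_n$ be the polynomials, $\Gamma$ the closed deltoid region, and $(Y_k)_{k\ge0}$ the Markov chain on $\mathbb{Z}$ defined in the context. For any fixed integer $n\ge 0$ and real $t>0$, $$\left| z^n-\sum_{k=0}^{\lfloor t\sqrt n\rfloor}\beta_k P_k(z)\right|\le 2e^{-t^2/7}\quad\text{for all } z\in\Gamma,$$ where $\beta_k=\mathbb{P}(|Y_n|=k)$.
   Context: The polynomials $P_n$, $n\ge0$, are defined by $P_0(z)=1$, $P_1(z)=z$, $P_2(z)=z^2$, and $P_{n+1}(z)=\tfrac32 zP_n(z)-\tfrac12P_{n-2}(z)$ for $n\ge2$. The deltoid curve $\gamma\subset\mathbb{C}$ is the closed curve $\gamma(t)=\frac23e^{it}+\frac13e^{-2it}$, $t\in[0,2\pi]$, and $\Gamma$ is the closure of the region enclosed by $\gamma$ (the curve together with the bounded component of its complement). $(Y_k)_{k\ge 0}$ is the (time-homogeneous) Markov chain on $\mathbb{Z}$ with $Y_0=0$ and transition probabilities $p_{j|i}=\mathbb{P}(Y_k=j\mid Y_{k-1}=i)$, $k\ge1$, given by $p_{1|0}=p_{-1|0}=\frac12$; $p_{2|1}=\frac34$, $p_{-2|1}=\frac14$; $p_{-2|-1}=\frac34$, $p_{2|-1}=\frac14$; and for every $i\ge2$: $p_{i+1|i}=\frac23$, $p_{i-2|i}=\frac13$, $p_{-i-1|-i}=\frac23$, $p_{-i+2|-i}=\frac13$ (all other transition probabilities are $0$). *)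

theory Defs
  imports "HOL-Probability.Probability" "HOL-Computational_Algebra.Polynomial"
begin

fun P :: "nat \<Rightarrow> complex poly" where
  "P 0 = 1"
| "P (Suc 0) = [:0, 1:]"
| "P (Suc (Suc 0)) = [:0, 1:] ^ 2"
| "P (Suc (Suc (Suc n))) = smult (3 / 2) ([:0, 1:] * P (Suc (Suc n))) - smult (1 / 2) (P n)"

definition deltoid_curve :: "real \<Rightarrow> complex" where
  "deltoid_curve t = 2 / 3 * exp (\<i> * of_real t) + 1 / 3 * exp (- 2 * \<i> * of_real t)"

text \<open>The closed region bounded by the curve; \<open>inside\<close> is the bounded part of the complement.\<close>

definition deltoid_region :: "complex set" where
  "deltoid_region =
     (let \<gamma> = deltoid_curve ` {0..2 * pi} in \<gamma> \<union> inside \<gamma>)"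

text \<open>\<open>a\<close> is the starting point and \<open>p i j\<close> the probability of a step from \<open>i\<close> to \<open>j\<close>. The Markov property is imposed
  only for histories of positive probability, where conditioning is elementary.\<close>

locale markov_chain = prob_space M
  for M :: "'a measure" and Y :: "nat \<Rightarrow> 'a \<Rightarrow> 's" and a :: 's and p :: "'s \<Rightarrow> 's \<Rightarrow> real" +
  assumes measurable_Y: "\<And>k. Y k \<in> measurable M (count_space UNIV)"
    and initial: "AE \<omega> in M. Y 0 \<omega> = a"
    and transition: "\<And>k y j.
      \<P>(\<omega> in M. \<forall>l\<le>k. Y l \<omega> = y l) > 0 \<Longrightarrow>
      \<P>(\<omega> in M. Y (Suc k) \<omega> = j \<bar> \<forall>l\<le>k. Y l \<omega> = y l) = p (y k) j"

definition deltoid_step :: "int \<Rightarrow> int \<Rightarrow> real" where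
  "deltoid_step i j =
    (if i = 0 then (if j = 1 \<or> j = -1 then 1 / 2 else 0)
     else if i = 1 then (if j = 2 then 3 / 4 else if j = -2 then 1 / 4 else 0)
     else if i = -1 then (if j = -2 then 3 / 4 else if j = 2 then 1 / 4 else 0)
     else if i \<ge> 2 then (if j = i + 1 then 2 / 3 else if j = i - 2 then 1 / 3 else 0)
     else (if j = i - 1 then 2 / 3 else if j = i + 2 then 1 / 3 else 0))"

end

theory Submission
  imports Defs "HOL-Complex_Analysis.Conformal_Mappings"
begin

text \<open>
  The recurrence of the \<open>P k\<close> turns multiplication by \<open>z\<close> into one step of the chain \<open>\<bar>Y\<bar>\<close>, so \<open>z ^ n\<close> is the
  expectation of \<open>P \<bar>Y n\<bar> z\<close>. As \<open>\<bar>P k z\<bar> \<le> 1\<close> on the deltoid region, the error is at most the probability that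
  \<open>\<bar>Y n\<bar> > t \<surd>n\<close>. One step multiplies the expectation of \<open>cosh (s \<bar>Y\<bar>)\<close> by at most \<open>cosh s ^ 3 \<le> exp (3 s\<^sup>2 / 2)\<close>, and
  Markov's inequality with \<open>s = t / (3 \<surd>n)\<close> gives the tail \<open>2 exp (- t\<^sup>2 / 6)\<close>.

  The bound on \<open>P k\<close> is needed only on the curve, by the maximum modulus principle. There
  \<open>z = 2/3 u + 1/3 u\<^sup>-\<^sup>2\<close> with \<open>\<bar>u\<bar> = 1\<close>, and \<open>u\<close> is a root of the characteristic polynomial of the recurrence. Subtracting
  from \<open>P k z\<close> its component \<open>(4/9 + 1/18 u\<^sup>-\<^sup>3) u ^ k\<close> along that root leaves a sequence with
  \<open>A (k + 2) = 1/2 u\<^sup>-\<^sup>2 A (k + 1) + 1/2 u\<^sup>-\<^sup>1 A k\<close>, which stays below \<open>1/2\<close> in modulus from \<open>k = 1\<close> on.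
\<close>

section \<open>The polynomials on the deltoid region\<close>

lemma poly_P_Suc3:
  "poly (P (Suc (Suc (Suc n)))) z = 3 / 2 * z * poly (P (Suc (Suc n))) z - 1 / 2 * poly (P n) z"
  by simp

lemma norm_P_le_1_on_curve:
  fixes u w z :: complex
  assumes uw: "u * w = 1" and u: "norm u = 1" and z: "z = 2 / 3 * u + 1 / 3 * w\<^sup>2"
  shows "norm (poly (P k) z) \<le> 1"
proof -
  have w: "norm w = 1"
    using arg_cong[OF uw, of norm] u by (simp add: norm_mult)
  \<comment> \<open>The characteristic polynomial of the recurrence is
    \<open>(x - u) * (x^2 - w^2/2 * x - w/2)\<close>. For distinct roots, the coefficient of
    \<open>u ^ n\<close> in \<open>P n\<close> is
    \<open>(z^2 - w^2/2 * z - w/2) / (u^2 - w)\<close>, which simplifies to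
    \<open>4/9 + 1/18 * w^3\<close>. The simplified form also serves at the cusps
    \<open>u^3 = 1\<close>, where \<open>u\<close> is a double root and the denominator
    vanishes.\<close>
  define A where "A = (\<lambda>n. poly (P n) z - 4 / 9 * u ^ n - 1 / 18 * u ^ n * w ^ 3)"
  have P_eq: "poly (P n) z = A n + 4 / 9 * u ^ n + 1 / 18 * u ^ n * w ^ 3" for n
    by (simp add: A_def)
  have A0: "A 0 = 5 / 9 - 1 / 18 * w ^ 3"
    by (simp add: A_def)
  have A1: "A 1 = 2 / 9 * u + 5 / 18 * w\<^sup>2"
    using uw unfolding A_def One_nat_def P.simps z by simp algebra
  have z32: "3 / 2 * z = u + 1 / 2 * w\<^sup>2"
    by (simp add: z)
  have uw2: "u * w\<^sup>2 = w" "u\<^sup>2 * w ^ 3 = w"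
    using uw by algebra+
  have "A 2 = z\<^sup>2 - 4 / 9 * u\<^sup>2 - 1 / 18 * (u\<^sup>2 * w ^ 3)"
    by (simp add: A_def numeral_2_eq_2)
  also have "z\<^sup>2 = 4 / 9 * u\<^sup>2 + 4 / 9 * (u * w\<^sup>2) + 1 / 9 * w ^ 4"
    unfolding z by (simp add: power2_eq_square power4_eq_xxxx algebra_simps)
  finally have A2: "A 2 = 7 / 18 * w + 1 / 9 * w ^ 4"
    unfolding uw2 by simp
  have "1 / 2 * w\<^sup>2 * A 1 + 1 / 2 * w * A 0 = 1 / 9 * (u * w\<^sup>2) + 5 / 18 * w + 1 / 9 * w ^ 4"
    unfolding A0 A1 by (simp add: power2_eq_square power3_eq_cube power4_eq_xxxx algebra_simps)
  then have rec0: "A (Suc (Suc 0)) = 1 / 2 * w\<^sup>2 * A (Suc 0) + 1 / 2 * w * A 0"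
    using A2 uw2 by (simp add: numeral_2_eq_2)
  \<comment> \<open>By the factorisation of the characteristic polynomial, the defect of this
    two-term recurrence is multiplied by \<open>u\<close> when \<open>n\<close> grows by one. It is
    zero at the start by \<open>rec0\<close>.\<close>
  have rec: "A (Suc (Suc n)) = 1 / 2 * w\<^sup>2 * A (Suc n) + 1 / 2 * w * A n" for n
  proof (induction n)
    case (Suc n)
    have "u ^ Suc (Suc n) * w\<^sup>2 = u ^ n * (u * w) ^ 2"
      by (simp add: power_mult_distrib power2_eq_square)
    then have cancel: "u ^ Suc (Suc n) * w\<^sup>2 = u ^ n"
      by (simp add: uw)
    have "A (Suc (Suc (Suc n))) = (u + 1 / 2 * w\<^sup>2) * A (Suc (Suc n)) - 1 / 2 * A n
        + 1 / 2 * (4 / 9 + 1 / 18 * w ^ 3) * (u ^ Suc (Suc n) * w\<^sup>2 - u ^ n)"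
      unfolding A_def poly_P_Suc3 z32 by (simp add: algebra_simps add_divide_distrib)
    moreover have "u * (1 / 2 * w * A n) = 1 / 2 * A n" "u * (1 / 2 * w\<^sup>2 * A (Suc n)) = 1 / 2 * w * A (Suc n)"
      using uw uw2(1) by (simp_all add: mult.assoc[symmetric])
    ultimately have "A (Suc (Suc (Suc n))) = 1 / 2 * w\<^sup>2 * A (Suc (Suc n)) + 1 / 2 * w * A (Suc n)
        + u * (A (Suc (Suc n)) - (1 / 2 * w\<^sup>2 * A (Suc n) + 1 / 2 * w * A n))"
      unfolding cancel right_diff_distrib distrib_left by (simp only:) (simp add: algebra_simps)
    then show ?case
      unfolding Suc by simp
  qed (rule rec0)
  have "norm (A 1) \<le> norm (2 / 9 * u) + norm (5 / 18 * w\<^sup>2)"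
    unfolding A1 by (rule norm_triangle_ineq)
  then have bound1: "norm (A (Suc 0)) \<le> 1 / 2"
    using u w by (simp add: norm_mult norm_power norm_divide)
  have "norm (A 2) \<le> norm (7 / 18 * w) + norm (1 / 9 * w ^ 4)"
    unfolding A2 by (rule norm_triangle_ineq)
  then have bound2: "norm (A (Suc (Suc 0))) \<le> 1 / 2"
    using w by (simp add: norm_mult norm_power norm_divide numeral_2_eq_2)
  \<comment> \<open>Both coefficients of \<open>rec\<close> have modulus 1/2, so a common bound on
    two consecutive terms persists. The index starts at 1 because \<open>A 0\<close> may exceed 1/2
    in modulus; \<open>P 0 = 1\<close> is treated directly.\<close>
  have bound: "norm (A (Suc n)) \<le> 1 / 2 \<and> norm (A (Suc (Suc n))) \<le> 1 / 2" for n
  proof (induction n)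
    case (Suc n)
    have "norm (A (Suc (Suc (Suc n))))
        \<le> norm (1 / 2 * w\<^sup>2 * A (Suc (Suc n))) + norm (1 / 2 * w * A (Suc n))"
      unfolding rec[of "Suc n"] by (rule norm_triangle_ineq)
    then show ?case
      using Suc w by (simp add: norm_mult norm_power norm_divide)
  qed (use bound1 bound2 in simp)
  show ?thesis
  proof (cases k)
    case (Suc m)
    have "norm (poly (P k) z) \<le> norm (A k) + norm (4 / 9 * u ^ k) + norm (1 / 18 * u ^ k * w ^ 3)"
      unfolding P_eq by (intro norm_triangle_le add_right_mono norm_triangle_ineq)
    also have "\<dots> \<le> 1 / 2 + 4 / 9 + 1 / 18"
      using bound[of m] u w Suc by (simp add: norm_mult norm_power norm_divide)
    finally show ?thesis by simp
  qed simp
qed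

lemma norm_P_le_1:
  assumes "z \<in> deltoid_region"
  shows "norm (poly (P k) z) \<le> 1"
proof -
  define C where "C = deltoid_curve ` {0..2 * pi}"
  have on_curve: "norm (poly (P k) x) \<le> 1" if "x \<in> C" for x
  proof -
    from that obtain t where t: "x = deltoid_curve t"
      by (auto simp: C_def)
    show ?thesis
    proof (rule norm_P_le_1_on_curve)
      show "exp (\<i> * of_real t) * exp (- \<i> * of_real t) = 1"
        by (simp flip: exp_add)
      show "x = 2 / 3 * exp (\<i> * of_real t) + 1 / 3 * (exp (- \<i> * of_real t))\<^sup>2"
        by (simp add: t deltoid_curve_def mult.assoc flip: exp_double)
    qed simp
  qed
  have "compact C"
    unfolding C_def deltoid_curve_def
    by (intro compact_continuous_image continuous_intros compact_Icc) auto
  have "norm (poly (P k) z) \<le> 1" if "z \<in> inside C"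
  proof (rule maximum_modulus_frontier[of "poly (P k)"])
    show "bounded (inside C)"
      by (simp add: \<open>compact C\<close> bounded_inside compact_imp_bounded)
    show "norm (poly (P k) x) \<le> 1" if "x \<in> frontier (inside C)" for x
      using that frontier_inside_subset[of C] \<open>compact C\<close> on_curve by (auto simp: compact_imp_closed)
  qed (use that in \<open>auto intro!: holomorphic_intros continuous_intros\<close>)
  with on_curve assms show ?thesis
    by (auto simp: deltoid_region_def C_def Let_def)
qed

section \<open>General tools: a Gaussian bound on cosh, and consecutive states of a Markov
  chain\<close>

lemma cosh_le_exp_square: "cosh x \<le> exp (x\<^sup>2 / 2)" for x :: real
proof -
  \<comment> \<open>Hoeffding's estimate for a fair coin: with \<open>h = 2 * |x|\<close> and
    \<open>p = 1/2\<close> the left side is \<open>ln (cosh x)\<close>, and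
    \<open>h^2 / 8 = x^2 / 2\<close>.\<close>
  have "-(2 * \<bar>x\<bar>) * (1/2) + ln (1 + 1/2 * (exp (2 * \<bar>x\<bar>) - 1)) \<le> (2 * \<bar>x\<bar>)\<^sup>2 / 8"
    using Hoeffdings_lemma_aux[of "2 * \<bar>x\<bar>" "1/2"] by (simp add: Let_def)
  moreover have "1 + 1/2 * (exp (2 * \<bar>x\<bar>) - 1) = exp \<bar>x\<bar> * cosh \<bar>x\<bar>"
    by (simp add: cosh_def field_simps flip: exp_add)
  ultimately have "ln (cosh x) \<le> x\<^sup>2 / 2"
    by (simp add: ln_mult power2_eq_square)
  then show ?thesis
    by (metis cosh_real_pos exp_le_cancel_iff exp_ln)
qed

context markov_chain
begin

declare measurable_Y [measurable]

text \<open>The product form of the Markov property needs no positivity condition, since both sides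
  vanish on a null history.\<close>

lemma history_step:
  "prob {\<omega> \<in> space M. Y (Suc k) \<omega> = j \<and> (\<forall>l\<le>k. Y l \<omega> = y l)}
     = p (y k) j * prob {\<omega> \<in> space M. \<forall>l\<le>k. Y l \<omega> = y l}"
proof (cases "prob {\<omega> \<in> space M. \<forall>l\<le>k. Y l \<omega> = y l} > 0")
  case True
  then show ?thesis
    using transition[of k y j] by (simp add: cond_prob_def field_simps)
next
  case False
  then have 0: "prob {\<omega> \<in> space M. \<forall>l\<le>k. Y l \<omega> = y l} = 0"
    by (simp add: zero_less_measure_iff)
  have "prob {\<omega> \<in> space M. Y (Suc k) \<omega> = j \<and> (\<forall>l\<le>k. Y l \<omega> = y l)}
      \<le> prob {\<omega> \<in> space M. \<forall>l\<le>k. Y l \<omega> = y l}"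
    by (rule finite_measure_mono) auto
  with 0 show ?thesis by (simp add: measure_le_0_iff)
qed

end

text \<open>The history is forgotten one time at a time, from the earliest on, by summing
  \<open>history_step\<close> over the countably many values of the state dropped. Working with
  \<open>emeasure\<close> lets the factor \<open>p i j\<close> leave the sum without any question of
  convergence.\<close>

lemma markov_chain_joint:
  fixes Y :: "nat \<Rightarrow> 'a \<Rightarrow> 's :: countable"
  assumes "markov_chain M Y a p" and p: "\<And>i j. p i j \<ge> 0"
  shows "\<P>(\<omega> in M. Y k \<omega> = i \<and> Y (Suc k) \<omega> = j) = p i j * \<P>(\<omega> in M. Y k \<omega> = i)"
proof -
  interpret markov_chain M Y a p by fact
  have forget: "prob {\<omega> \<in> space M. Y (Suc k) \<omega> = j \<and> (\<forall>l\<in>{m..k}. Y l \<omega> = y l)}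
      = p (y k) j * prob {\<omega> \<in> space M. \<forall>l\<in>{m..k}. Y l \<omega> = y l}" if "m \<le> k" for m y
    using that
  proof (induction m arbitrary: y)
    case 0
    then show ?case
      using history_step[of k j y] by (simp add: Ball_def)
  next
    case (Suc m)
    \<comment> \<open>The events are split by the value \<open>i\<close> of \<open>Y m\<close>.
      Since \<open>m < k\<close>, the update of \<open>y\<close> at \<open>m\<close> leaves
      \<open>y k\<close> unchanged, so the factor \<open>p (y k) j\<close> is the same for all
      pieces.\<close>
    define D where "D = (\<lambda>Q i. {\<omega> \<in> space M. Q \<omega> \<and> (\<forall>l\<in>{m..k}. Y l \<omega> = (y(m := i)) l)})"
    have split: "{\<omega> \<in> space M. Q \<omega> \<and> (\<forall>l\<in>{Suc m..k}. Y l \<omega> = y l)} = (\<Union>i. D Q i)" for Q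
      using Suc.prems by (auto simp: D_def Icc_eq_insert_lb_nat[of m k])
    have disj: "disjoint_family (D Q)" for Q
      using Suc.prems by (auto simp: D_def disjoint_family_on_def Icc_eq_insert_lb_nat[of m k])
    have sets: "D (\<lambda>\<omega>. Y (Suc k) \<omega> = j) i \<in> sets M" "D (\<lambda>_. True) i \<in> sets M" for i
      unfolding D_def by measurable
    have IH: "emeasure M (D (\<lambda>\<omega>. Y (Suc k) \<omega> = j) i) = p (y k) j * emeasure M (D (\<lambda>_. True) i)" for i
      using Suc.IH[of "y(m := i)"] Suc.prems p by (simp add: D_def emeasure_eq_measure ennreal_mult)
    have "emeasure M {\<omega> \<in> space M. Y (Suc k) \<omega> = j \<and> (\<forall>l\<in>{Suc m..k}. Y l \<omega> = y l)}
        = p (y k) j * emeasure M {\<omega> \<in> space M. True \<and> (\<forall>l\<in>{Suc m..k}. Y l \<omega> = y l)}"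
      unfolding split by (subst (1 2) emeasure_UN_countable) (simp_all add: disj sets IH nn_integral_cmult)
    then show ?case
      using p by (simp add: emeasure_eq_measure flip: ennreal_mult)
  qed
  from forget[of k "\<lambda>_. i"] show ?thesis
    by (simp add: conj_commute)
qed

section \<open>The transition operator of the absolute value of the chain\<close>

lemma deltoid_step_nonneg: "deltoid_step i j \<ge> 0"
  by (simp add: deltoid_step_def)

lemma deltoid_step_bound: "deltoid_step i j \<noteq> 0 \<Longrightarrow> \<bar>j\<bar> \<le> \<bar>i\<bar> + 1"
  by (auto simp: deltoid_step_def split: if_splits)

text \<open>The kernel is invariant under changing the sign of both states, so \<open>|Y|\<close>
  moves as a chain on the naturals, and this is its one-step expectation operator. Values in a real
  vector space allow both polynomial values and cosh as \<open>g\<close>.\<close>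

fun abs_step :: "(nat \<Rightarrow> 'b :: real_vector) \<Rightarrow> nat \<Rightarrow> 'b" where
  "abs_step g 0 = g 1"
| "abs_step g (Suc 0) = g 2"
| "abs_step g (Suc (Suc m)) = (2 / 3) *\<^sub>R g (Suc (Suc (Suc m))) + (1 / 3) *\<^sub>R g m"

lemma sum_deltoid_step:
  fixes g :: "nat \<Rightarrow> 'b :: real_vector"
  assumes "\<bar>i\<bar> \<le> int n"
  shows "(\<Sum>j = - int (Suc n)..int (Suc n). deltoid_step i j *\<^sub>R g (nat \<bar>j\<bar>))
    = abs_step g (nat \<bar>i\<bar>)"
proof -
  \<comment> \<open>\<open>J\<close> will be the support of row \<open>i\<close>. By
    \<open>deltoid_step_bound\<close> it fits into the window, which is one wider than the range of
    \<open>i\<close>.\<close>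
  have restrict: "(\<Sum>j = - int (Suc n)..int (Suc n). deltoid_step i j *\<^sub>R g (nat \<bar>j\<bar>))
      = (\<Sum>j\<in>J. deltoid_step i j *\<^sub>R g (nat \<bar>j\<bar>))"
    if "finite J" "\<And>j. j \<notin> J \<Longrightarrow> deltoid_step i j = 0" "\<And>j. j \<in> J \<Longrightarrow> deltoid_step i j \<noteq> 0" for J
  proof (rule sum.mono_neutral_right)
    show "J \<subseteq> {- int (Suc n)..int (Suc n)}"
      using deltoid_step_bound that(3) assms by fastforce
  qed (use that in auto)
  consider "i = 0" | "i = 1" | "i = -1" | m where "i = int m + 2" | m where "i = - int m - 2"
  proof -
    assume *: "i = 0 \<Longrightarrow> thesis" "i = 1 \<Longrightarrow> thesis" "i = -1 \<Longrightarrow> thesis"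
      "\<And>m. i = int m + 2 \<Longrightarrow> thesis" "\<And>m. i = - int m - 2 \<Longrightarrow> thesis"
    have "i = 0 \<or> i = 1 \<or> i = -1 \<or> i = int (nat (i - 2)) + 2 \<or> i = - int (nat (- i - 2)) - 2"
      by linarith
    with * show thesis by blast
  qed
  then show ?thesis
  proof cases
    case 1
    then show ?thesis
      by (subst restrict[of "{1, -1}"])
        (auto simp: deltoid_step_def simp flip: scaleR_add_left split: if_splits)
  next
    case 2
    then show ?thesis
      by (subst restrict[of "{2, -2}"])
        (auto simp: deltoid_step_def simp flip: scaleR_add_left split: if_splits)
  next
    case 3
    then show ?thesis
      by (subst restrict[of "{2, -2}"])
        (auto simp: deltoid_step_def simp flip: scaleR_add_left split: if_splits)
  next
    case (4 m)
    then have "nat \<bar>i\<bar> = Suc (Suc m)" "nat \<bar>int m + 3\<bar> = Suc (Suc (Suc m))" by auto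
    then show ?thesis
      unfolding 4 by (subst restrict[of "{int m + 3, int m}", unfolded 4])
        (auto simp: deltoid_step_def 4 split: if_splits)
  next
    case (5 m)
    then have "nat \<bar>i\<bar> = Suc (Suc m)" "nat \<bar>- int m - 3\<bar> = Suc (Suc (Suc m))" by auto
    then show ?thesis
      unfolding 5 by (subst restrict[of "{- int m - 3, - int m}", unfolded 5])
        (auto simp: deltoid_step_def 5 split: if_splits)
  qed
qed

text \<open>Multiplied by 2/3, the recurrence reads
  \<open>z * P (m+2) = 2/3 * P (m+3) + 1/3 * P m\<close>, whose weights are those of the step out of
  \<open>m + 2\<close>.\<close>

lemma abs_step_P: "abs_step (\<lambda>k. poly (P k) z) k = z * poly (P k) z"
  by (cases k rule: P.cases)
    (simp_all add: numeral_2_eq_2 scaleR_conv_of_real algebra_simps)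

text \<open>The exponent 3 is forced by the sure step from 1 to 2: to second order in
  \<open>s\<close>, \<open>cosh (2 * s)\<close> agrees with \<open>cosh s ^ 4\<close>. From 2 on the
  step has mean zero, and the sinh part that remains is nonpositive.\<close>

lemma abs_step_cosh:
  fixes s :: real
  assumes "s \<ge> 0"
  shows "abs_step (\<lambda>k. cosh (s * real k)) k \<le> cosh s ^ 3 * cosh (s * real k)"
proof -
  define c where "c = cosh s"
  have c: "c \<ge> 1"
    by (simp add: c_def cosh_real_ge_1)
  consider "k = 0" | "k = 1" | m where "k = Suc (Suc m)"
    by (metis One_nat_def not0_implies_Suc)
  then show ?thesis
  proof cases
    case 1
    have "c ^ 1 \<le> c ^ 3"
      by (intro power_increasing c) simp
    with 1 show ?thesis
      by (simp add: c_def)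
  next
    case 2
    have "0 \<le> (c\<^sup>2 - 1)\<^sup>2"
      by simp
    then have "2 * c\<^sup>2 - 1 \<le> c ^ 3 * c"
      by (simp add: power2_eq_square power3_eq_cube algebra_simps)
    with 2 show ?thesis
      by (simp add: c_def cosh_double_cosh mult.commute[of s])
  next
    case (3 m)
    define x where "x = s * real k"
    have x: "x \<ge> 0" "s * real (Suc (Suc (Suc m))) = x + s" "s * real m = x - 2 * s"
      using assms 3 by (simp_all add: x_def algebra_simps)
    \<comment> \<open>The product equals \<open>3 * c^3 - 2 * c^2 - 2 * c + 1\<close>, three times
      the difference needed next.\<close>
    have "0 \<le> (c - 1) * (3 * c\<^sup>2 + c - 1)"
      using c by (intro mult_nonneg_nonneg) (use zero_le_power2[of c] in linarith)+
    then have "2 / 3 * c + 1 / 3 * (2 * c\<^sup>2 - 1) \<le> c ^ 3"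
      by (simp add: power2_eq_square power3_eq_cube algebra_simps)
    then have "cosh x * (2 / 3 * c + 1 / 3 * (2 * c\<^sup>2 - 1)) \<le> cosh x * c ^ 3"
      by (intro mult_left_mono) simp_all
    moreover have "0 \<le> 2 / 3 * sinh x * sinh s * (c - 1)"
      using assms x c by (intro mult_nonneg_nonneg) simp_all
    moreover have "abs_step (\<lambda>k. cosh (s * real k)) k
        = cosh x * (2 / 3 * c + 1 / 3 * (2 * c\<^sup>2 - 1)) - 2 / 3 * sinh x * sinh s * (c - 1)"
      unfolding 3 abs_step.simps x cosh_add cosh_diff cosh_double_cosh sinh_double
      by (simp add: c_def field_simps)
    ultimately have "abs_step (\<lambda>k. cosh (s * real k)) k \<le> cosh x * c ^ 3"
      by linarith
    then show ?thesis
      by (simp add: x_def c_def mult.commute)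
  qed
qed

section \<open>The law of the absolute value of the deltoid chain\<close>

locale deltoid_chain = markov_chain M Y 0 deltoid_step
  for M :: "'a measure" and Y :: "nat \<Rightarrow> 'a \<Rightarrow> int"
begin

lemma joint:
  "\<P>(\<omega> in M. Y k \<omega> = i \<and> Y (Suc k) \<omega> = j) = deltoid_step i j * \<P>(\<omega> in M. Y k \<omega> = i)"
  by (rule markov_chain_joint[OF markov_chain_axioms deltoid_step_nonneg])

text \<open>This makes all expectations below finite sums. Each forbidden transition has probability
  zero, and there are only countably many pairs of states.\<close>

lemma AE_abs_le: "AE \<omega> in M. \<bar>Y k \<omega>\<bar> \<le> int k"
proof (induction k)
  case 0
  show ?case
    using initial by simp
next
  case (Suc k)
  have "AE \<omega> in M. deltoid_step i j = 0 \<longrightarrow> \<not> (Y k \<omega> = i \<and> Y (Suc k) \<omega> = j)" for i j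
  proof (cases "deltoid_step i j = 0")
    case True
    then have "\<P>(\<omega> in M. Y k \<omega> = i \<and> Y (Suc k) \<omega> = j) = 0"
      by (simp add: joint)
    then show ?thesis
      by (subst (asm) prob_eq_0) (simp_all add: True)
  qed simp
  then have "AE \<omega> in M. \<forall>i j. deltoid_step i j = 0 \<longrightarrow> \<not> (Y k \<omega> = i \<and> Y (Suc k) \<omega> = j)"
    by (intro AE_all_countable[THEN iffD2] allI)
  with Suc show ?case
  proof eventually_elim
    case (elim \<omega>)
    then have "deltoid_step (Y k \<omega>) (Y (Suc k) \<omega>) \<noteq> 0"
      by blast
    with elim(1) deltoid_step_bound[of "Y k \<omega>" "Y (Suc k) \<omega>"] show ?case
      by simp
  qed
qed

lemma law_Suc:
  "\<P>(\<omega> in M. Y (Suc n) \<omega> = j)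
     = (\<Sum>i = - int n..int n. deltoid_step i j * \<P>(\<omega> in M. Y n \<omega> = i))"
proof -
  have "AE \<omega> in M. Y n \<omega> \<in> {- int n..int n}"
    using AE_abs_le[of n] by eventually_elim auto
  then have "AE \<omega> in M.
      (\<forall>i\<in>{- int n..int n}. Y n \<omega> = i \<and> Y (Suc n) \<omega> = j \<longrightarrow> Y (Suc n) \<omega> = j) \<and>
      (Y (Suc n) \<omega> = j \<longrightarrow> (\<exists>!i\<in>{- int n..int n}. Y n \<omega> = i \<and> Y (Suc n) \<omega> = j))"
    by eventually_elim auto
  then have "\<P>(\<omega> in M. Y (Suc n) \<omega> = j)
      = (\<Sum>i = - int n..int n. \<P>(\<omega> in M. Y n \<omega> = i \<and> Y (Suc n) \<omega> = j))"
    by (intro prob_sum) measurable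
  then show ?thesis
    by (simp only: joint)
qed

definition abs_law :: "nat \<Rightarrow> nat \<Rightarrow> real" where
  "abs_law n k = \<P>(\<omega> in M. \<bar>Y n \<omega>\<bar> = int k)"

lemma abs_law_nonneg: "abs_law n k \<ge> 0"
  by (simp add: abs_law_def)

lemma abs_law_0: "abs_law 0 0 = 1"
  unfolding abs_law_def using initial by (simp add: prob_Collect_eq_1)

lemma abs_law_eq_0: "n < k \<Longrightarrow> abs_law n k = 0"
  unfolding abs_law_def using AE_abs_le[of n] by (subst prob_eq_0) (auto elim: eventually_mono)

lemma abs_law_eq_sum:
  "abs_law n k = (\<Sum>i | i \<in> {- int n..int n} \<and> nat \<bar>i\<bar> = k. \<P>(\<omega> in M. Y n \<omega> = i))"
  unfolding abs_law_def
proof (rule prob_sum)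
  show "AE \<omega> in M. (\<forall>i\<in>{i \<in> {- int n..int n}. nat \<bar>i\<bar> = k}. Y n \<omega> = i \<longrightarrow> \<bar>Y n \<omega>\<bar> = int k) \<and>
      (\<bar>Y n \<omega>\<bar> = int k \<longrightarrow> (\<exists>!i\<in>{i \<in> {- int n..int n}. nat \<bar>i\<bar> = k}. Y n \<omega> = i))"
    using AE_abs_le[of n] by eventually_elim auto
qed (auto intro: finite_subset[of _ "{- int n..int n}"])

lemma sum_abs_law:
  fixes g :: "nat \<Rightarrow> 'b :: real_vector"
  shows "(\<Sum>i = - int n..int n. \<P>(\<omega> in M. Y n \<omega> = i) *\<^sub>R g (nat \<bar>i\<bar>)) = (\<Sum>k\<le>n. abs_law n k *\<^sub>R g k)"
proof -
  have "(\<Sum>k\<le>n. abs_law n k *\<^sub>R g k)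
      = (\<Sum>k\<le>n. \<Sum>i | i \<in> {- int n..int n} \<and> nat \<bar>i\<bar> = k. \<P>(\<omega> in M. Y n \<omega> = i) *\<^sub>R g (nat \<bar>i\<bar>))"
    unfolding abs_law_eq_sum scaleR_sum_left by (intro sum.cong refl) simp
  also have "\<dots> = (\<Sum>i = - int n..int n. \<P>(\<omega> in M. Y n \<omega> = i) *\<^sub>R g (nat \<bar>i\<bar>))"
    by (rule sum.group) auto
  finally show ?thesis ..
qed

text \<open>Duality between the evolution of the law and the transition operator. The expansion of
  \<open>z ^ n\<close> and the bound on the cosh moment are both inductions on it.\<close>

lemma sum_abs_law_Suc:
  fixes g :: "nat \<Rightarrow> 'b :: real_vector"
  shows "(\<Sum>k\<le>Suc n. abs_law (Suc n) k *\<^sub>R g k) = (\<Sum>k\<le>n. abs_law n k *\<^sub>R abs_step g k)"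
proof -
  let ?\<mu> = "\<lambda>i. \<P>(\<omega> in M. Y n \<omega> = i)"
  have "(\<Sum>k\<le>Suc n. abs_law (Suc n) k *\<^sub>R g k)
      = (\<Sum>j = - int (Suc n)..int (Suc n). \<Sum>i = - int n..int n.
          (deltoid_step i j * ?\<mu> i) *\<^sub>R g (nat \<bar>j\<bar>))"
    by (simp only: sum_abs_law[symmetric] law_Suc scaleR_sum_left)
  also have "\<dots> = (\<Sum>i = - int n..int n. \<Sum>j = - int (Suc n)..int (Suc n).
          (deltoid_step i j * ?\<mu> i) *\<^sub>R g (nat \<bar>j\<bar>))"
    by (rule sum.swap)
  also have "\<dots> = (\<Sum>i = - int n..int n. ?\<mu> i *\<^sub>R
          (\<Sum>j = - int (Suc n)..int (Suc n). deltoid_step i j *\<^sub>R g (nat \<bar>j\<bar>)))"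
    by (simp only: scaleR_sum_right scaleR_scaleR mult.commute)
  also have "\<dots> = (\<Sum>i = - int n..int n. ?\<mu> i *\<^sub>R abs_step g (nat \<bar>i\<bar>))"
    by (intro sum.cong refl arg_cong2[where f = scaleR] sum_deltoid_step) auto
  also have "\<dots> = (\<Sum>k\<le>n. abs_law n k *\<^sub>R abs_step g k)"
    by (rule sum_abs_law)
  finally show ?thesis .
qed

lemma power_eq_sum_P: "(\<Sum>k\<le>n. abs_law n k *\<^sub>R poly (P k) z) = z ^ n"
proof (induction n)
  case (Suc n)
  have "(\<Sum>k\<le>Suc n. abs_law (Suc n) k *\<^sub>R poly (P k) z) = z * (\<Sum>k\<le>n. abs_law n k *\<^sub>R poly (P k) z)"
    unfolding sum_abs_law_Suc abs_step_P by (simp add: sum_distrib_left)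
  then show ?case
    unfolding Suc by simp
qed (simp add: abs_law_0)

lemma sum_cosh_le:
  assumes "s \<ge> 0"
  shows "(\<Sum>k\<le>n. abs_law n k * cosh (s * real k)) \<le> exp (3 / 2 * s\<^sup>2 * real n)"
proof -
  have "(\<Sum>k\<le>n. abs_law n k *\<^sub>R cosh (s * real k)) \<le> (cosh s ^ 3) ^ n"
  proof (induction n)
    case (Suc n)
    have "(\<Sum>k\<le>n. abs_law n k *\<^sub>R abs_step (\<lambda>k. cosh (s * real k)) k)
        \<le> (\<Sum>k\<le>n. abs_law n k *\<^sub>R (cosh s ^ 3 * cosh (s * real k)))"
      by (intro sum_mono scaleR_left_mono abs_step_cosh assms abs_law_nonneg)
    also have "\<dots> = cosh s ^ 3 * (\<Sum>k\<le>n. abs_law n k *\<^sub>R cosh (s * real k))"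
      by (simp add: sum_distrib_left mult_ac)
    also have "\<dots> \<le> cosh s ^ 3 * (cosh s ^ 3) ^ n"
      by (intro mult_left_mono Suc) simp
    finally show ?case
      unfolding sum_abs_law_Suc by simp
  qed (simp add: abs_law_0)
  also have "(cosh s ^ 3) ^ n \<le> (exp (s\<^sup>2 / 2) ^ 3) ^ n"
    by (intro power_mono cosh_le_exp_square) simp_all
  also have "\<dots> = exp (3 / 2 * s\<^sup>2 * real n)"
    by (simp flip: exp_of_nat_mult add: mult_ac)
  finally show ?thesis by simp
qed

text \<open>A Chernoff bound with cosh in place of exp: \<open>cosh x \<ge> exp x / 2\<close> costs
  the factor 2 in the result.\<close>

lemma tail_bound:
  assumes "s \<ge> 0" "a \<ge> 0" "finite K" and K: "\<And>k. k \<in> K \<Longrightarrow> a \<le> real k"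
  shows "(\<Sum>k\<in>K. abs_law n k) \<le> 2 * exp (3 / 2 * s\<^sup>2 * real n - s * a)"
proof -
  have "(\<Sum>k\<in>K. abs_law n k) * (exp (s * a) / 2) \<le> (\<Sum>k\<in>K. abs_law n k * cosh (s * real k))"
    unfolding sum_distrib_right
  proof (intro sum_mono mult_left_mono abs_law_nonneg)
    fix k assume "k \<in> K"
    have "exp (s * a) / 2 \<le> cosh (s * a)"
      by (simp add: cosh_def)
    also have "\<dots> \<le> cosh (s * real k)"
      using assms(1,2) K[OF \<open>k \<in> K\<close>] by (subst cosh_real_nonneg_le_iff) (simp_all add: mult_left_mono)
    finally show "exp (s * a) / 2 \<le> cosh (s * real k)" .
  qed
  also have "\<dots> = (\<Sum>k\<in>K \<inter> {..n}. abs_law n k * cosh (s * real k))"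
    using \<open>finite K\<close> by (intro sum.mono_neutral_right) (auto dest: abs_law_eq_0 simp flip: not_less)
  also have "\<dots> \<le> (\<Sum>k\<le>n. abs_law n k * cosh (s * real k))"
    by (intro sum_mono2) (auto simp: abs_law_nonneg)
  also have "\<dots> \<le> exp (3 / 2 * s\<^sup>2 * real n)"
    by (rule sum_cosh_le) fact
  finally show ?thesis
    by (simp only: exp_diff) (simp add: field_simps)
qed

end

section \<open>Truncation of the expansion and choice of the parameter\<close>

theorem theorem3:
  fixes M :: "'a measure" and Y :: "nat \<Rightarrow> 'a \<Rightarrow> int" and n :: nat and t :: real
  assumes "markov_chain M Y 0 deltoid_step" and "t > 0"
  shows "\<forall>z \<in> deltoid_region.
    cmod (z ^ n - (\<Sum>k = 0..nat \<lfloor>t * sqrt (real n)\<rfloor>.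
       complex_of_real (\<P>(\<omega> in M. \<bar>Y n \<omega>\<bar> = int k)) * poly (P k) z))
    \<le> 2 * exp (- (t\<^sup>2) / 7)"
proof
  fix z assume z: "z \<in> deltoid_region"
  interpret deltoid_chain M Y
    using assms(1) by (simp add: deltoid_chain_def)
  define N where "N = nat \<lfloor>t * sqrt (real n)\<rfloor>"
  define f where "f = (\<lambda>k. abs_law n k *\<^sub>R poly (P k) z)"
  have "z ^ n = (\<Sum>k\<le>n. f k)"
    by (simp add: f_def power_eq_sum_P)
  \<comment> \<open>\<open>N\<close> may be larger than \<open>n\<close>; the coefficients beyond
    \<open>n\<close> are zero.\<close>
  also have "\<dots> = (\<Sum>k\<le>max n N. f k)"
    by (intro sum.mono_neutral_left) (auto simp: f_def abs_law_eq_0)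
  also have "\<dots> = (\<Sum>k\<le>N. f k) + (\<Sum>k\<in>{N<..max n N}. f k)"
    by (subst sum.union_disjoint[symmetric]) (auto intro!: sum.cong)
  finally have "cmod (z ^ n - (\<Sum>k\<le>N. f k)) = cmod (\<Sum>k\<in>{N<..max n N}. f k)"
    by simp
  also have "\<dots> \<le> (\<Sum>k\<in>{N<..max n N}. abs_law n k)"
    using norm_P_le_1[OF z]
    by (intro sum_norm_le) (simp add: f_def abs_law_nonneg mult_left_le)
  also have "\<dots> \<le> 2 * exp (- (t\<^sup>2) / 7)"
  proof (cases "n = 0")
    \<comment> \<open>Here \<open>N = 0\<close> and the index set is empty; the parameter
      \<open>s\<close> of the other case would divide by zero.\<close>
    case True
    then show ?thesis
      by (simp add: N_def)
  next
    case False
    \<comment> \<open>The minimiser of the exponent \<open>3/2 * s^2 * n - s * t * sqrt n\<close>,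
      with minimum \<open>- t^2 / 6\<close>.\<close>
    define s where "s = t / (3 * sqrt (real n))"
    have "(\<Sum>k\<in>{N<..max n N}. abs_law n k) \<le> 2 * exp (3 / 2 * s\<^sup>2 * real n - s * (t * sqrt (real n)))"
    proof (rule tail_bound)
      fix k assume "k \<in> {N<..max n N}"
      then show "t * sqrt (real n) \<le> real k"
        unfolding N_def by (simp add: nat_less_iff) linarith
    qed (use assms(2) in \<open>simp_all add: s_def\<close>)
    also have "3 / 2 * s\<^sup>2 * real n - s * (t * sqrt (real n)) = - (t\<^sup>2) / 6"
      using False by (simp add: s_def power_divide power_mult_distrib field_simps power2_eq_square)
    also have "exp (- (t\<^sup>2) / 6) \<le> exp (- (t\<^sup>2) / 7)"
      by simp
    finally show ?thesis by simp
  qed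
  finally show "cmod (z ^ n - (\<Sum>k = 0..nat \<lfloor>t * sqrt (real n)\<rfloor>.
       complex_of_real (\<P>(\<omega> in M. \<bar>Y n \<omega>\<bar> = int k)) * poly (P k) z)) \<le> 2 * exp (- (t\<^sup>2) / 7)"
    by (simp add: f_def abs_law_def N_def scaleR_conv_of_real atLeast0AtMost)
qed

end
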